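(* Let $n\ge 1$, let $p_1,\dots,p_n\in[0,1]$, put $\lambda=p_1+\dots+p_n$ and $\lambda_2=p_1^2+\dots+p_n^2$, let $W=X_1+\dots+X_n$ where $X_1,\dots,X_n$ are independent Bernoulli random variables with $\mathbb{P}\{X_j=1\}=p_j$, $\mathbb{P}\{X_j=0\}=1-p_j$, and let $Z$ be a Poisson random variable with parameter $\lambda$. If $\lambda\ge 1/2$ and $\lambda_2\le\kappa\lambda$ with $\kappa\in(0,1)$, then $$\frac14\Big(\frac{\lambda_2}{\lambda}\Big)^2\le D(W\|Z)\le\chi^2(W,Z)\le c_\kappa\Big(\frac{\lambda_2}{\lambda}\Big)^2,$$ where $c_\kappa=c\,(1-\kappa)^{-3}$ and one may take $c=7\cdot 10^6$.
   Context: Write $w_k=\mathbb{P}\{W=k\}$ and $v_k=\mathbb{P}\{Z=k\}=\frac{\lambda^k}{k!}e^{-\lambda}$ for $k=0,1,2,\dots$. The relative entropy is $D(W\|Z)=\sum_{k=0}^\infty w_k\log\frac{w_k}{v_k}$ (natural logarithm, with $0\log 0=0$). The Pearson $\chi^2$-distance is $\chi^2(W,Z)=\sum_{k=0}^\infty\frac{(w_k-v_k)^2}{v_k}$. *)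

theory Defs
  imports "HOL-Probability.Probability"
begin

definition mass :: "'a measure \<Rightarrow> ('a \<Rightarrow> nat) \<Rightarrow> nat \<Rightarrow> real" where
  "mass M X k = measure M {\<omega> \<in> space M. X \<omega> = k}"

text \<open>
  The two distances below are meant for mass functions \<open>w\<close>, \<open>v\<close> on the natural numbers with
  \<open>v k > 0\<close> for all \<open>k\<close>, as is the case for a Poisson law of positive rate: if \<open>v k = 0\<close>, totality of
  division makes the \<open>k\<close>-th term \<open>0\<close>. The convention \<open>0 log 0 = 0\<close> holds because of the factor \<open>w k\<close>.
  A divergent series has an unspecified value, so statements bounding these
  quantities should also assert convergence.
\<close>

definition relative_entropy :: "(nat \<Rightarrow> real) \<Rightarrow> (nat \<Rightarrow> real) \<Rightarrow> real" where
  "relative_entropy w v = (\<Sum>k. w k * ln (w k / v k))"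

definition chi2_distance :: "(nat \<Rightarrow> real) \<Rightarrow> (nat \<Rightarrow> real) \<Rightarrow> real" where
  "chi2_distance w v = (\<Sum>k. (w k - v k)\<^sup>2 / v k)"

end

theory Submission
  imports Defs "HOL-Complex_Analysis.Complex_Analysis"
begin

text \<open>
  Lower bound. By Gibbs' inequality, \<open>D(W\<parallel>Z) \<ge> E f(W) - log E exp(f(Z))\<close> for every \<open>f\<close>. Take
  \<open>f(k) = - u Y(k) - u\<^sup>2/\<lambda> (k - \<lambda>)\<close>, where \<open>Y(k) = (k(k-1) - 2\<lambda>k + \<lambda>\<^sup>2)/\<lambda>\<close> is the second Charlier polynomial.
  Stein's identity \<open>\<lambda> E g(Z+1) = E Z g(Z)\<close> turns the \<open>u\<close>-derivative of \<open>E exp(f(Z))\<close> into a second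
  difference, which gives \<open>E exp(f(Z)) \<le> exp(u\<^sup>2)\<close>. As \<open>E Y(W) = -\<lambda>\<^sub>2/\<lambda>\<close>, the choice
  \<open>u = \<lambda>\<^sub>2/(2\<lambda>)\<close> gives the constant \<open>1/4\<close>.

  Upper bound. Let \<open>A(z) = \<Prod>(1 + p\<^sub>i z) exp(- p\<^sub>i z) = \<Sum> a\<^sub>j z\<^sup>j\<close>. Then \<open>\<Sum> w\<^sub>k x\<^sup>k = A(x-1) exp(\<lambda>(x-1))\<close>, and the
  orthogonality of the Charlier functions gives \<open>\<chi>\<^sup>2 \<le> \<Sum> a\<^sub>j\<^sup>2 j!/\<lambda>\<^sup>j\<close>, summed over \<open>j \<ge> 2\<close>. Since
  \<open>|1 + w|\<^sup>2 exp(- 2 Re w) \<le> exp(|w|\<^sup>2)\<close>, the function \<open>A\<close> is bounded by \<open>exp(\<lambda>\<^sub>2|z|\<^sup>2/2)\<close>, and Cauchy's inequality on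
  the circle of radius \<open>\<surd>(j/\<lambda>\<^sub>2)\<close> yields \<open>a\<^sub>j\<^sup>2 j! \<le> e j \<lambda>\<^sub>2\<^sup>j\<close>. The sum is therefore at most
  \<open>2e (\<lambda>\<^sub>2/\<lambda>)\<^sup>2 / (1 - \<lambda>\<^sub>2/\<lambda>)\<^sup>2\<close>.
\<close>

section \<open>An exponential moment of the second Charlier polynomial\<close>

definition poisson_mass :: "real \<Rightarrow> nat \<Rightarrow> real" where
  "poisson_mass l k = l ^ k / fact k * exp (- l)"

definition charlier2 :: "real \<Rightarrow> nat \<Rightarrow> real" where
  "charlier2 l k = (real k * (real k - 1) - 2 * l * real k + l\<^sup>2) / l"

definition tilt :: "real \<Rightarrow> real \<Rightarrow> nat \<Rightarrow> real" where
  "tilt l u k = exp (- u * charlier2 l k - u\<^sup>2 / l * (real k - l))"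

lemma poisson_mass_pos: "l > 0 \<Longrightarrow> poisson_mass l k > 0"
  by (simp add: poisson_mass_def)

lemma poisson_mass_Suc: "real (Suc k) * poisson_mass l (Suc k) = l * poisson_mass l k"
  by (simp add: poisson_mass_def divide_simps del: of_nat_Suc)

lemma poisson_mass_sums: "poisson_mass l sums 1"
proof -
  have "(\<lambda>k. l ^ k / fact k * exp (- l)) sums (exp l * exp (- l))"
    by (intro sums_mult2) (use exp_converges[of l] in \<open>simp add: field_simps scaleR_conv_of_real\<close>)
  then show ?thesis
    by (simp add: poisson_mass_def[abs_def] exp_minus)
qed

text \<open>The exponent is quadratic in \<open>k\<close> with second difference
  \<open>- 2 * u / l\<close>, so the mean of its values at \<open>k\<close> and \<open>k + 2\<close>
  is the middle value minus \<open>u / l\<close>. The inequality between arithmetic and geometric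
  means and \<open>exp (- t) \<ge> 1 - t\<close> then suffice.\<close>

lemma tilt_second_difference:
  assumes "l > 0" "u \<ge> 0"
  shows "tilt l u (Suc (Suc k)) - (2 - 2 * (u / l)) * tilt l u (Suc k) + tilt l u k \<ge> 0"
proof -
  define E where "E k = - u * charlier2 l k - u\<^sup>2 / l * (real k - l)" for k
  have sum_E: "E k / 2 + E (Suc (Suc k)) / 2 = E (Suc k) - u / l"
    using assms by (simp add: E_def charlier2_def field_simps power2_eq_square)
  have sq: "exp (x / 2) * exp (x / 2) = exp x" for x :: real
    by (simp flip: exp_add)
  have "0 \<le> (exp (E k / 2) - exp (E (Suc (Suc k)) / 2))\<^sup>2"
    by simp
  also have "\<dots> = exp (E k) + exp (E (Suc (Suc k))) - 2 * exp (E k / 2 + E (Suc (Suc k)) / 2)"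
    by (simp add: power2_eq_square algebra_simps sq exp_add)
  also have "\<dots> = exp (E k) + exp (E (Suc (Suc k))) - 2 * (exp (E (Suc k)) * exp (- (u / l)))"
    by (simp add: sum_E flip: exp_add)
  also have "\<dots> \<le> exp (E k) + exp (E (Suc (Suc k))) - 2 * (exp (E (Suc k)) * (1 - u / l))"
    using exp_ge_add_one_self[of "- (u / l)"] by simp
  finally show ?thesis
    by (simp add: tilt_def E_def algebra_simps)
qed

text \<open>Completing the square in \<open>k\<close> leaves a bound uniform in \<open>k\<close> and
  in \<open>u\<close> up to \<open>b\<close>; it will make truncation errors vanish.\<close>

lemma tilt_le:
  assumes "l > 0" "0 \<le> u" "u \<le> b"
  shows "tilt l u k \<le> exp (b * (1 + 1 / (4 * l)) + b\<^sup>2)"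
proof -
  have "- u * charlier2 l k - u\<^sup>2 / l * (real k - l)
      = u * (1 + 1 / (4 * l)) + u\<^sup>2 - (u / l) * (real k - l - 1/2)\<^sup>2 - u\<^sup>2 / l * real k"
    using assms by (simp add: charlier2_def field_simps power2_eq_square)
  also have "\<dots> \<le> u * (1 + 1 / (4 * l)) + u\<^sup>2"
  proof -
    have "(u / l) * (real k - l - 1/2)\<^sup>2 \<ge> 0" "u\<^sup>2 / l * real k \<ge> 0"
      using assms by simp_all
    then show ?thesis by linarith
  qed
  also have "\<dots> \<le> b * (1 + 1 / (4 * l)) + b\<^sup>2"
    using assms by (intro add_mono mult_right_mono power_mono) auto
  finally show ?thesis
    by (simp add: tilt_def)
qed

lemma DERIV_tilt:
  assumes "l > 0"
  shows "((\<lambda>u. tilt l u k) has_real_derivative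
     (- charlier2 l k - 2 * u / l * (real k - l)) * tilt l u k) (at u)"
  unfolding tilt_def using assms by (auto intro!: derivative_eq_intros)

text \<open>Summation by parts. By the Poisson recurrence, the coefficient of
  \<open>tilt l u k\<close> is minus \<open>l\<close> times the adjoint second difference of the
  weights. Moving the differences onto \<open>tilt\<close> gives nonpositive terms, and the
  right-hand side collects the boundary terms of the truncation.\<close>

lemma tilted_drift_sum_le:
  assumes l: "l > 0" and u: "u \<ge> 0"
  shows "(\<Sum>k<Suc (Suc m). poisson_mass l k *
           (- charlier2 l k - 2 * u / l * (real k - l) - 2 * u) * tilt l u k)
    \<le> l * poisson_mass l m * ((2 - 2 * (u / l)) * tilt l u (Suc m) - tilt l u m)
       - l * poisson_mass l (Suc m) * tilt l u (Suc m)"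
proof (induction m)
  case 0
  have "poisson_mass l (Suc 0) = l * poisson_mass l 0"
    using poisson_mass_Suc[of 0 l] by simp
  then show ?case
    using l by (simp add: charlier2_def field_simps power2_eq_square)
next
  case (Suc m)
  define T where "T k = poisson_mass l k *
           (- charlier2 l k - 2 * u / l * (real k - l) - 2 * u) * tilt l u k" for k
  let ?a = "poisson_mass l m" and ?b = "poisson_mass l (Suc m)" and ?c = "poisson_mass l (Suc (Suc m))"
  have b: "?a = real (Suc m) * ?b / l" and c: "?b = real (Suc (Suc m)) * ?c / l"
    using poisson_mass_Suc[of m l] poisson_mass_Suc[of "Suc m" l] l by (simp_all add: field_simps)
  have T: "T (Suc (Suc m)) = - l * ?a * tilt l u (Suc (Suc m))
     + (2 - 2 * (u / l)) * l * ?b * tilt l u (Suc (Suc m)) - l * ?c * tilt l u (Suc (Suc m))"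
    unfolding T_def b c charlier2_def using l by (simp add: field_simps power2_eq_square)
  have "0 \<le> l * ?a * (tilt l u (Suc (Suc m)) - (2 - 2 * (u / l)) * tilt l u (Suc m) + tilt l u m)"
    using tilt_second_difference[OF l u] poisson_mass_pos[OF l, of m] l by simp
  moreover have "(\<Sum>k<Suc (Suc (Suc m)). T k) = (\<Sum>k<Suc (Suc m). T k) + T (Suc (Suc m))"
    by (rule sum.lessThan_Suc)
  ultimately show ?case
    using Suc.IH T unfolding T_def[symmetric]
    by (simp only: ring_distribs mult_ac)
qed

text \<open>
  The linear term in \<^const>\<open>tilt\<close> is free, since the Poisson law and the law of \<open>W\<close> have the
  same mean. Its coefficient makes the differential inequality behind the next lemma hold
  pointwise, after a Stein shift.
\<close>

lemma tilted_sum_le: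
  assumes l: "l > 0" and b: "b \<ge> 0"
  shows "(\<Sum>k\<le>n. poisson_mass l k * tilt l b k) \<le> exp (b\<^sup>2)"
proof -
  define C where "C = exp (b * (1 + 1 / (4 * l)) + b\<^sup>2)"
  \<comment> \<open>The sum is truncated so that it can be differentiated in \<open>u\<close> term
    by term; the factor \<open>exp (- u\<^sup>2)\<close> contributes the \<open>- 2 * u\<close> in
    \<open>H\<close>.\<close>
  define F where "F m u = (\<Sum>k<Suc (Suc m). poisson_mass l k * tilt l u k) * exp (- u\<^sup>2)" for m u
  define H where "H m u = (\<Sum>k<Suc (Suc m). poisson_mass l k *
           (- charlier2 l k - 2 * u / l * (real k - l) - 2 * u) * tilt l u k)" for m u
  have deriv: "(F m has_real_derivative H m u * exp (- u\<^sup>2)) (at u)" for m u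
  proof -
    have "(F m has_real_derivative
        (\<Sum>k<Suc (Suc m). poisson_mass l k *
           ((- charlier2 l k - 2 * u / l * (real k - l)) * tilt l u k)) * exp (- u\<^sup>2)
        + exp (- u\<^sup>2) * (- (2 * u)) * (\<Sum>k<Suc (Suc m). poisson_mass l k * tilt l u k)) (at u)"
      unfolding F_def
      by (intro DERIV_mult DERIV_sum DERIV_cmult DERIV_tilt l) (auto intro!: derivative_eq_intros)
    also have "(\<Sum>k<Suc (Suc m). poisson_mass l k *
           ((- charlier2 l k - 2 * u / l * (real k - l)) * tilt l u k)) * exp (- u\<^sup>2)
        + exp (- u\<^sup>2) * (- (2 * u)) * (\<Sum>k<Suc (Suc m). poisson_mass l k * tilt l u k)
        = H m u * exp (- u\<^sup>2)"
      unfolding H_def sum_distrib_left sum_distrib_right sum.distrib[symmetric]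
      by (intro sum.cong) (simp_all only: ring_distribs mult_ac, simp_all)
    finally show ?thesis .
  qed
  \<comment> \<open>Only the positive boundary term is kept; its Poisson weight tends to 0 as
    \<open>m\<close> grows, while \<open>n\<close> stays fixed.\<close>
  have H_le: "H m u * exp (- u\<^sup>2) \<le> 2 * l * C * poisson_mass l m" if "0 \<le> u" "u \<le> b" for m u
  proof -
    have "H m u \<le> l * poisson_mass l m * ((2 - 2 * (u / l)) * tilt l u (Suc m) - tilt l u m)
       - l * poisson_mass l (Suc m) * tilt l u (Suc m)"
      unfolding H_def using tilted_drift_sum_le[OF l that(1)] .
    also have "\<dots> \<le> l * poisson_mass l m * (2 * tilt l u (Suc m) - 0) - 0"
      using l that poisson_mass_pos[OF l]
      by (intro diff_mono mult_left_mono mult_right_mono mult_nonneg_nonneg)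
         (auto simp: tilt_def less_imp_le)
    also have "\<dots> \<le> l * poisson_mass l m * (2 * C - 0) - 0"
      using l that poisson_mass_pos[OF l, of m] tilt_le[OF l that]
      by (intro diff_mono mult_left_mono) (auto simp: C_def)
    finally have H: "H m u \<le> 2 * l * C * poisson_mass l m"
      by (simp add: mult_ac)
    have "H m u * exp (- u\<^sup>2) \<le> 2 * l * C * poisson_mass l m * exp (- u\<^sup>2)"
      using H by (rule mult_right_mono) simp
    also have "\<dots> \<le> 2 * l * C * poisson_mass l m * 1"
      using l poisson_mass_pos[OF l, of m] by (intro mult_left_mono) (auto simp: C_def)
    finally show ?thesis by simp
  qed
  have F_0: "F m 0 \<le> 1" for m
    using sum_le_suminf[OF sums_summable[OF poisson_mass_sums[of l]], of "{..<Suc (Suc m)}"]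
      poisson_mass_pos[OF l] sums_unique[OF poisson_mass_sums[of l]]
    by (simp add: F_def tilt_def less_imp_le)
  have F_b: "F m b \<le> 1 + b * (2 * l * C * poisson_mass l m)" for m
  proof (cases "b = 0")
    case True
    then show ?thesis using F_0 by simp
  next
    case False
    then have "0 < b" using b by simp
    from MVT2[OF this deriv] obtain z where
      z: "0 < z" "z < b" "F m b - F m 0 = (b - 0) * (H m z * exp (- z\<^sup>2))" by blast
    then show ?thesis
      using F_0[of m] mult_left_mono[OF H_le[of z m] b] by (simp only: diff_zero) linarith
  qed
  have "(\<Sum>k\<le>n. poisson_mass l k * tilt l b k) * exp (- b\<^sup>2) \<le> 1 + b * (2 * l * C * poisson_mass l m)"
    if "m \<ge> n" for m
  proof -
    have "(\<Sum>k\<le>n. poisson_mass l k * tilt l b k) \<le> (\<Sum>k<Suc (Suc m). poisson_mass l k * tilt l b k)"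
      using that poisson_mass_pos[OF l] by (intro sum_mono2) (auto simp: tilt_def less_imp_le)
    then have "(\<Sum>k\<le>n. poisson_mass l k * tilt l b k) * exp (- b\<^sup>2) \<le> F m b"
      unfolding F_def by (rule mult_right_mono) simp
    also note F_b
    finally show ?thesis .
  qed
  moreover have "(\<lambda>m. 1 + b * (2 * l * C * poisson_mass l m)) \<longlonglongrightarrow> 1 + b * (2 * l * C * 0)"
    by (intro tendsto_intros summable_LIMSEQ_zero sums_summable[OF poisson_mass_sums])
  ultimately have "(\<Sum>k\<le>n. poisson_mass l k * tilt l b k) * exp (- b\<^sup>2) \<le> 1 + b * (2 * l * C * 0)"
    by (intro LIMSEQ_le_const) auto
  then show ?thesis
    by (simp add: exp_minus field_simps)
qed

section \<open>Lower bound for the relative entropy\<close>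

text \<open>Gibbs' inequality against \<open>q\<close>, a sub-probability by
  \<open>tilted_sum_le\<close>. The linear part of the tilt has mean zero under \<open>w\<close>, so
  the bound is \<open>u * d / l - u\<^sup>2\<close>.\<close>

lemma entropy_lower_bound:
  fixes w :: "nat \<Rightarrow> real"
  assumes l: "l > 0" and d: "d \<ge> 0" and w: "\<And>k. w k \<ge> 0"
    and w0: "(\<Sum>k\<le>n. w k) = 1" and w1: "(\<Sum>k\<le>n. w k * real k) = l"
    and w2: "(\<Sum>k\<le>n. w k * (real k * (real k - 1))) = l\<^sup>2 - d"
  shows "1/4 * (d / l)\<^sup>2 \<le> (\<Sum>k\<le>n. w k * ln (w k / poisson_mass l k))"
proof -
  \<comment> \<open>This is the maximiser of \<open>u * d / l - u\<^sup>2\<close>.\<close>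
  define u where "u = d / (2 * l)"
  have u: "u \<ge> 0" using d l by (simp add: u_def)
  define q where "q k = poisson_mass l k * tilt l u k * exp (- u\<^sup>2)" for k
  have q: "q k > 0" for k
    using poisson_mass_pos[OF l] by (simp add: q_def tilt_def)
  have q_le: "(\<Sum>k\<le>n. q k) \<le> 1"
    using tilted_sum_le[OF l u, of n]
    by (simp add: q_def exp_minus field_simps flip: sum_distrib_right sum_divide_distrib)
  have pointwise: "w k - q k + w k * (- u * charlier2 l k - u\<^sup>2 / l * (real k - l) - u\<^sup>2)
      \<le> w k * ln (w k / poisson_mass l k)" for k
  proof (cases "w k = 0")
    case True
    then show ?thesis using q[of k] by simp
  next
    case False
    then have wk: "w k > 0" using w[of k] by simp
    have "ln (w k / poisson_mass l k) = ln (w k / q k) + (- u * charlier2 l k - u\<^sup>2 / l * (real k - l) - u\<^sup>2)"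
      using wk poisson_mass_pos[OF l, of k] by (simp add: q_def tilt_def ln_div ln_mult)
    moreover have "w k - q k \<le> w k * ln (w k / q k)"
    proof -
      have "ln (q k / w k) \<le> q k / w k - 1"
        using wk q by (intro ln_le_minus_one) simp
      then have "w k * ln (q k / w k) \<le> w k * (q k / w k - 1)"
        using wk by (intro mult_left_mono) auto
      then show ?thesis using wk q[of k] by (simp add: ln_div algebra_simps)
    qed
    ultimately show ?thesis by (simp only: distrib_left)
  qed
  have "(\<Sum>k\<le>n. w k * (- u * charlier2 l k - u\<^sup>2 / l * (real k - l) - u\<^sup>2))
      = (\<Sum>k\<le>n. - (u / l) * (w k * (real k * (real k - 1))) + (2 * u - u\<^sup>2 / l) * (w k * real k) - u * l * w k)"
    using l by (intro sum.cong) (auto simp: charlier2_def field_simps power2_eq_square)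
  also have "\<dots> = - (u / l) * (l\<^sup>2 - d) + (2 * u - u\<^sup>2 / l) * l - u * l"
    by (simp only: sum.distrib sum_subtractf sum_distrib_left[symmetric] w0 w1 w2)
  also have "\<dots> = 1/4 * (d / l)\<^sup>2"
    using l by (simp add: u_def field_simps power2_eq_square)
  finally have "1/4 * (d / l)\<^sup>2 = (\<Sum>k\<le>n. w k * (- u * charlier2 l k - u\<^sup>2 / l * (real k - l) - u\<^sup>2))" ..
  also have "\<dots> \<le> (\<Sum>k\<le>n. w k - q k + w k * (- u * charlier2 l k - u\<^sup>2 / l * (real k - l) - u\<^sup>2))"
    using q_le by (simp add: sum.distrib sum_subtractf w0)
  also have "\<dots> \<le> (\<Sum>k\<le>n. w k * ln (w k / poisson_mass l k))"
    by (intro sum_mono pointwise)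
  finally show ?thesis .
qed

section \<open>Orthogonality of the Charlier functions\<close>

text \<open>
  \<open>charlier_mass l j\<close> has the generating function \<open>(x - 1)\<^sup>j exp(l(x - 1))\<close>; divided by the Poisson
  weights it is a multiple of the \<open>j\<close>-th Charlier polynomial.
\<close>

fun charlier_mass :: "real \<Rightarrow> nat \<Rightarrow> nat \<Rightarrow> real" where
  "charlier_mass l 0 k = poisson_mass l k"
| "charlier_mass l (Suc j) k = (case k of 0 \<Rightarrow> 0 | Suc i \<Rightarrow> charlier_mass l j i) - charlier_mass l j k"

text \<open>Coefficient form of
  \<open>G' - l * G = m * (x - 1) ^ (m - 1) * exp (l * (x - 1))\<close> for the generating function
  \<open>G\<close> of \<open>charlier_mass l m\<close>.\<close>

lemma charlier_mass_lowering:
  "real (Suc k) * charlier_mass l m (Suc k) - l * charlier_mass l m k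
    = (case m of 0 \<Rightarrow> 0 | Suc i \<Rightarrow> real m * charlier_mass l i k)"
proof (induction m arbitrary: k)
  case 0
  then show ?case by (simp add: poisson_mass_Suc del: of_nat_Suc)
next
  case (Suc m)
  show ?case
  proof (cases k)
    case 0
    then show ?thesis
      using Suc.IH[of 0] by (cases m) (auto simp: algebra_simps)
  next
    case (Suc i)
    then show ?thesis
      using Suc.IH[of k] Suc.IH[of i] by (cases m) (auto simp: algebra_simps)
  qed
qed

text \<open>Each shift of the index multiplies the Poisson weight by \<open>k / l\<close>, so the
  quotient by that weight grows at most polynomially. This secures summability of the products
  below.\<close>

lemma abs_charlier_mass_le:
  assumes l: "l > 0"
  shows "\<bar>charlier_mass l j k\<bar> \<le> (1 + 1 / l) ^ j * real (Suc k) ^ j * poisson_mass l k"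
proof (induction j arbitrary: k)
  case 0
  then show ?case using poisson_mass_pos[OF l, of k] by simp
next
  case (Suc j)
  let ?B = "(1 + 1 / l) ^ j * real (Suc k) ^ j"
  have B: "?B \<ge> 0" using l by simp
  have "\<bar>case k of 0 \<Rightarrow> 0 | Suc i \<Rightarrow> charlier_mass l j i\<bar> \<le> ?B * (real k / l * poisson_mass l k)"
  proof (cases k)
    case 0
    then show ?thesis by simp
  next
    case k: (Suc i)
    have "\<bar>charlier_mass l j i\<bar> \<le> (1 + 1 / l) ^ j * real (Suc i) ^ j * poisson_mass l i"
      by (rule Suc.IH)
    also have "\<dots> \<le> (1 + 1 / l) ^ j * real (Suc k) ^ j * poisson_mass l i"
      using k l poisson_mass_pos[OF l, of i]
      by (intro mult_right_mono mult_left_mono power_mono) auto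
    also have "poisson_mass l i = real k / l * poisson_mass l k"
      using poisson_mass_Suc[of i l] l k by (simp add: field_simps)
    finally show ?thesis using k by simp
  qed
  moreover have "\<bar>charlier_mass l j k\<bar> \<le> ?B * poisson_mass l k"
    by (rule Suc.IH)
  ultimately have "\<bar>charlier_mass l (Suc j) k\<bar> \<le> ?B * ((real k / l + 1) * poisson_mass l k)"
    by (simp only: charlier_mass.simps distrib_left distrib_right)
  also have "\<dots> \<le> ?B * ((1 + 1 / l) * real (Suc k) * poisson_mass l k)"
    using l poisson_mass_pos[OF l, of k]
    by (intro mult_left_mono mult_right_mono B) (auto simp: field_simps)
  finally show ?case by (simp add: mult_ac)
qed

text \<open>One factor \<open>k\<close> is absorbed by shifting the Poisson index, which lowers the
  power by one.\<close>

lemma summable_power_poisson_mass: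
  assumes l: "l > 0"
  shows "summable (\<lambda>k. real (Suc k) ^ m * poisson_mass l k)"
proof (induction m)
  case 0
  then show ?case using sums_summable[OF poisson_mass_sums[of l]] by simp
next
  case (Suc m)
  have "summable (\<lambda>k. real (Suc (Suc k)) ^ m * (real (Suc k) * poisson_mass l (Suc k)))"
  proof (rule summable_comparison_test')
    show "summable (\<lambda>k. 2 ^ m * l * (real (Suc k) ^ m * poisson_mass l k))"
      by (intro summable_mult Suc.IH)
    show "norm (real (Suc (Suc k)) ^ m * (real (Suc k) * poisson_mass l (Suc k)))
      \<le> 2 ^ m * l * (real (Suc k) ^ m * poisson_mass l k)" if "k \<ge> 0" for k
    proof -
      have "real (Suc (Suc k)) ^ m \<le> (2 * real (Suc k)) ^ m"
        by (intro power_mono) auto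
      then have "real (Suc (Suc k)) ^ m * (l * poisson_mass l k)
          \<le> (2 * real (Suc k)) ^ m * (l * poisson_mass l k)"
        using l poisson_mass_pos[OF l, of k] by (intro mult_right_mono) auto
      then show ?thesis
        using l poisson_mass_pos[OF l, of k]
        by (simp add: poisson_mass_Suc abs_mult power_mult_distrib mult_ac del: of_nat_Suc)
    qed
  qed
  then have "summable (\<lambda>k. real (Suc k) ^ m * (real k * poisson_mass l k))"
    by (subst summable_Suc_iff[symmetric]) simp
  from summable_add[OF this Suc.IH] show ?case
    by (simp add: algebra_simps)
qed

lemma summable_charlier_mass_mult:
  assumes l: "l > 0"
  shows "summable (\<lambda>k. charlier_mass l i k * charlier_mass l j k / poisson_mass l k)"
proof (rule summable_comparison_test')
  show "summable (\<lambda>k. (1 + 1 / l) ^ (i + j) * (real (Suc k) ^ (i + j) * poisson_mass l k))"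
    by (intro summable_mult summable_power_poisson_mass l)
  show "norm (charlier_mass l i k * charlier_mass l j k / poisson_mass l k)
    \<le> (1 + 1 / l) ^ (i + j) * (real (Suc k) ^ (i + j) * poisson_mass l k)" if "k \<ge> 0" for k
  proof -
    have v: "poisson_mass l k > 0" by (rule poisson_mass_pos[OF l])
    have "\<bar>charlier_mass l i k\<bar> * \<bar>charlier_mass l j k\<bar>
        \<le> ((1 + 1 / l) ^ i * real (Suc k) ^ i * poisson_mass l k)
          * ((1 + 1 / l) ^ j * real (Suc k) ^ j * poisson_mass l k)"
      using l v by (intro mult_mono abs_charlier_mass_le) auto
    then show ?thesis
      using v by (simp add: abs_mult pos_divide_le_eq power_add mult_ac del: of_nat_Suc)
  qed
qed

text \<open>Raising and lowering are adjoint up to the factor \<open>1 / l\<close>: after an index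
  shift, the lowering relation applies to the second factor, and the undifferenced sums
  cancel.\<close>

lemma suminf_charlier_mass_raising:
  assumes l: "l > 0"
  shows "(\<Sum>k. charlier_mass l (Suc j) k * charlier_mass l m k / poisson_mass l k)
    = (case m of 0 \<Rightarrow> 0
       | Suc i \<Rightarrow> real m / l * (\<Sum>k. charlier_mass l j k * charlier_mass l i k / poisson_mass l k))"
proof -
  define T where "T i j k = charlier_mass l i k * charlier_mass l j k / poisson_mass l k" for i j k
  define S where "S k = (case k of 0 \<Rightarrow> 0 | Suc i \<Rightarrow> charlier_mass l j i) * charlier_mass l m k / poisson_mass l k" for k
  have T: "summable (T i j)" for i j
    unfolding T_def by (rule summable_charlier_mass_mult[OF l])
  have S_eq: "S k = T (Suc j) m k + T j m k" for k
    by (simp add: S_def T_def algebra_simps diff_divide_distrib)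
  have S: "summable S"
    using summable_add[OF T[of "Suc j" m] T[of j m]] by (simp add: S_eq[abs_def])
  have S_Suc: "S (Suc k) = T j m k + (case m of 0 \<Rightarrow> 0 | Suc i \<Rightarrow> real m / l * T j i k)" for k
  proof -
    define R where "R = (case m of 0 \<Rightarrow> 0 | Suc i \<Rightarrow> real m * charlier_mass l i k)"
    have R: "(case m of 0 \<Rightarrow> 0 | Suc i \<Rightarrow> real m / l * T j i k)
        = charlier_mass l j k * R / (l * poisson_mass l k)"
      by (cases m) (simp_all add: R_def T_def)
    have "S (Suc k) = charlier_mass l j k * (real (Suc k) * charlier_mass l m (Suc k)) / (l * poisson_mass l k)"
      unfolding poisson_mass_Suc[symmetric] by (simp add: S_def del: of_nat_Suc)
    also have "real (Suc k) * charlier_mass l m (Suc k) = l * charlier_mass l m k + R"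
      using charlier_mass_lowering[of k l m] unfolding R_def by linarith
    finally show ?thesis
      unfolding R using l poisson_mass_pos[OF l, of k] by (simp add: T_def field_simps)
  qed
  have "suminf (T (Suc j) m) + suminf (T j m) = suminf S"
    using suminf_add[OF T[of "Suc j" m] T[of j m]] by (simp add: S_eq[abs_def])
  also have "\<dots> = (\<Sum>k. S (Suc k))"
    using suminf_split_head[OF S] by (simp add: S_def)
  also have "\<dots> = suminf (T j m) + (case m of 0 \<Rightarrow> 0 | Suc i \<Rightarrow> real m / l * suminf (T j i))"
  proof (cases m)
    case (Suc i)
    then show ?thesis
      using suminf_add[OF T[of j m] summable_mult[OF T[of j i], of "real m / l"]]
        suminf_mult[OF T[of j i], of "real m / l"]
      unfolding S_Suc by (simp del: of_nat_Suc)
  qed (simp add: S_Suc)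
  finally show ?thesis
    by (simp add: T_def[abs_def] del: charlier_mass.simps split: nat.split)
qed

lemma charlier_mass_orthogonal:
  assumes l: "l > 0"
  shows "(\<lambda>k. charlier_mass l i k * charlier_mass l j k / poisson_mass l k) sums
    (if i = j then fact j / l ^ j else 0)"
proof -
  have "(\<Sum>k. charlier_mass l i k * charlier_mass l j k / poisson_mass l k)
      = (if i = j then fact j / l ^ j else 0)"
  \<comment> \<open>Each step lowers both indices by one. For \<open>i = 0\<close> and positive
    \<open>j\<close>, symmetry puts the raised index first, and raising against index 0 gives
    0.\<close>
  proof (induction i arbitrary: j)
    case 0
    show ?case
    proof (cases j)
      case 0
      then show ?thesis
        using sums_unique[OF poisson_mass_sums[of l]] poisson_mass_pos[OF l] by (simp add: less_imp_neq[symmetric])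
    next
      case (Suc i)
      then show ?thesis
        using suminf_charlier_mass_raising[OF l, of i 0] by (simp add: mult.commute del: charlier_mass.simps)
    qed
  next
    case (Suc i)
    then show ?case
      unfolding suminf_charlier_mass_raising[OF l] by (cases j) (auto simp del: of_nat_Suc simp: fact_Suc)
  qed
  then show ?thesis
    using summable_sums[OF summable_charlier_mass_mult[OF l, of i j]] by simp
qed

text \<open>Parseval's identity for finite Charlier sums.\<close>

lemma charlier_mass_sum_norm:
  assumes l: "l > 0" and J: "finite J"
  shows "(\<lambda>k. (\<Sum>j\<in>J. c j * charlier_mass l j k)\<^sup>2 / poisson_mass l k) sums (\<Sum>j\<in>J. (c j)\<^sup>2 * fact j / l ^ j)"
proof -
  have "(\<lambda>k. \<Sum>i\<in>J. \<Sum>j\<in>J. c i * c j * (charlier_mass l i k * charlier_mass l j k / poisson_mass l k))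
      sums (\<Sum>i\<in>J. \<Sum>j\<in>J. c i * c j * (if i = j then fact j / l ^ j else 0))"
    by (intro sums_sum sums_mult charlier_mass_orthogonal l)
  also have "(\<Sum>i\<in>J. \<Sum>j\<in>J. c i * c j * (if i = j then fact j / l ^ j else 0))
      = (\<Sum>j\<in>J. (c j)\<^sup>2 * fact j / l ^ j)"
    using J by (intro sum.cong) (simp_all add: power2_eq_square if_distrib cong: if_cong)
  also have "(\<lambda>k. \<Sum>i\<in>J. \<Sum>j\<in>J. c i * c j * (charlier_mass l i k * charlier_mass l j k / poisson_mass l k))
      = (\<lambda>k. (\<Sum>j\<in>J. c j * charlier_mass l j k)\<^sup>2 / poisson_mass l k)"
    by (simp add: power2_eq_square sum_product sum_divide_distrib mult_ac)
  finally show ?thesis .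
qed

text \<open>A Fatou argument: for finitely many \<open>k\<close> the bound passes to the pointwise
  limit in \<open>m\<close>, and only then does the range of \<open>k\<close> grow.\<close>

lemma charlier_expansion_norm_le:
  assumes l: "l > 0"
    and lim: "\<And>k. (\<lambda>m. \<Sum>j<m. c j * charlier_mass l j k) \<longlonglongrightarrow> d k"
    and B: "\<And>m. (\<Sum>j<m. (c j)\<^sup>2 * fact j / l ^ j) \<le> B"
  shows "summable (\<lambda>k. (d k)\<^sup>2 / poisson_mass l k)"
    and "(\<Sum>k. (d k)\<^sup>2 / poisson_mass l k) \<le> B"
proof -
  have nonneg: "x\<^sup>2 / poisson_mass l k \<ge> 0" for x k
    using poisson_mass_pos[OF l, of k] by simp
  have partial: "(\<Sum>k<K. (d k)\<^sup>2 / poisson_mass l k) \<le> B" for K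
  proof (rule LIMSEQ_le_const2)
    show "(\<lambda>m. \<Sum>k<K. (\<Sum>j<m. c j * charlier_mass l j k)\<^sup>2 / poisson_mass l k)
        \<longlonglongrightarrow> (\<Sum>k<K. (d k)\<^sup>2 / poisson_mass l k)"
      using poisson_mass_pos[OF l] by (intro tendsto_intros lim) (metis less_irrefl)
    have "(\<Sum>k<K. (\<Sum>j<m. c j * charlier_mass l j k)\<^sup>2 / poisson_mass l k) \<le> B" for m
    proof -
      note sums = charlier_mass_sum_norm[OF l, of "{..<m}" c]
      have "(\<Sum>k<K. (\<Sum>j<m. c j * charlier_mass l j k)\<^sup>2 / poisson_mass l k)
          \<le> (\<Sum>j<m. (c j)\<^sup>2 * fact j / l ^ j)"
        using sum_le_suminf[OF sums_summable[OF sums], of "{..<K}"] sums_unique[OF sums] nonneg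
        by simp
      then show ?thesis using B[of m] by linarith
    qed
    then show "\<exists>N. \<forall>m\<ge>N. (\<Sum>k<K. (\<Sum>j<m. c j * charlier_mass l j k)\<^sup>2 / poisson_mass l k) \<le> B"
      by blast
  qed
  show "summable (\<lambda>k. (d k)\<^sup>2 / poisson_mass l k)"
    by (rule summableI_nonneg_bounded[OF nonneg partial])
  then show "(\<Sum>k. (d k)\<^sup>2 / poisson_mass l k) \<le> B"
    using partial by (rule suminf_le_const)
qed

section \<open>The Charlier expansion of a Bernoulli sum\<close>

lemma has_fps_expansion_charlier_mass:
  "(\<lambda>x::complex. (x - 1) ^ j * exp (of_real l * (x - 1))) has_fps_expansion
     Abs_fps (\<lambda>k. of_real (charlier_mass l j k))"
proof (induction j)
  case 0
  have "(\<lambda>x::complex. exp (of_real (- l)) * exp (of_real l * x)) has_fps_expansion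
      fps_const (exp (of_real (- l))) * fps_exp (of_real l)"
    by (intro fps_expansion_intros)
  also have "fps_const (exp (of_real (- l))) * fps_exp (of_real l)
      = Abs_fps (\<lambda>k. of_real (charlier_mass l 0 k) :: complex)"
    by (intro fps_ext) (simp add: poisson_mass_def exp_of_real[symmetric])
  also have "(\<lambda>x::complex. exp (of_real (- l)) * exp (of_real l * x))
      = (\<lambda>x. (x - 1) ^ 0 * exp (of_real l * (x - 1)))"
    by (simp add: exp_add[symmetric] algebra_simps)
  finally show ?case .
next
  case (Suc j)
  have "(\<lambda>x::complex. (x - 1) * ((x - 1) ^ j * exp (of_real l * (x - 1)))) has_fps_expansion
      (fps_X - 1) * Abs_fps (\<lambda>k. of_real (charlier_mass l j k))"
    by (intro fps_expansion_intros Suc.IH)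
  also have "(fps_X - 1) * Abs_fps (\<lambda>k. of_real (charlier_mass l j k))
      = Abs_fps (\<lambda>k. of_real (charlier_mass l (Suc j) k) :: complex)"
    by (intro fps_ext) (auto simp: left_diff_distrib split: nat.split)
  finally show ?case by (simp add: mult.assoc)
qed

section \<open>Cauchy estimates for the quotient of the generating functions\<close>

definition centered_gf :: "'i set \<Rightarrow> ('i \<Rightarrow> real) \<Rightarrow> complex \<Rightarrow> complex" where
  "centered_gf I p z = (\<Prod>i\<in>I. (1 + of_real (p i) * z) * exp (- (of_real (p i) * z)))"

lemma norm_one_plus_times_exp_le:
  fixes z :: complex
  shows "norm ((1 + z) * exp (- z)) \<le> exp ((norm z)\<^sup>2 / 2)"
proof (rule power2_le_imp_le)
  have "(norm ((1 + z) * exp (- z)))\<^sup>2 = (norm (1 + z))\<^sup>2 * exp (- (2 * Re z))"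
    by (simp add: norm_mult power_mult_distrib power2_eq_square flip: exp_add)
  also have "(norm (1 + z))\<^sup>2 = 1 + (2 * Re z + (norm z)\<^sup>2)"
    by (simp add: cmod_power2) (simp add: power2_eq_square algebra_simps)
  also have "(1 + (2 * Re z + (norm z)\<^sup>2)) * exp (- (2 * Re z))
      \<le> exp (2 * Re z + (norm z)\<^sup>2) * exp (- (2 * Re z))"
    by (intro mult_right_mono exp_ge_add_one_self) simp
  also have "\<dots> = (exp ((norm z)\<^sup>2 / 2))\<^sup>2"
    by (simp add: power2_eq_square flip: exp_add)
  finally show "(norm ((1 + z) * exp (- z)))\<^sup>2 \<le> (exp ((norm z)\<^sup>2 / 2))\<^sup>2" .
qed simp

lemma norm_centered_gf_le:
  "norm (centered_gf I p z) \<le> exp ((\<Sum>i\<in>I. (p i)\<^sup>2) * (norm z)\<^sup>2 / 2)"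
\<comment> \<open>For infinite \<open>I\<close> the product defaults to 1 and the sum to 0.\<close>
proof (cases "finite I")
  case True
  have "norm (centered_gf I p z) \<le> (\<Prod>i\<in>I. exp ((norm (of_real (p i) * z))\<^sup>2 / 2))"
    unfolding centered_gf_def prod_norm[symmetric]
    by (intro prod_mono conjI norm_ge_zero norm_one_plus_times_exp_le)
  also have "\<dots> = exp ((\<Sum>i\<in>I. (p i)\<^sup>2) * (norm z)\<^sup>2 / 2)"
    using True
    by (simp add: exp_sum[symmetric] norm_mult power_mult_distrib sum_distrib_right sum_divide_distrib)
  finally show ?thesis .
qed (simp add: centered_gf_def)

lemma holomorphic_centered_gf [holomorphic_intros]: "centered_gf I p holomorphic_on S"
  unfolding centered_gf_def by (intro holomorphic_intros)

text \<open>Every factor has value 1 and derivative 0 at the origin; hence the Charlier expansion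
  has no term of index 1.\<close>

lemma deriv_centered_gf_0: "deriv (centered_gf I p) 0 = 0"
proof -
  have "(centered_gf I p has_field_derivative 0) (at 0)"
    unfolding centered_gf_def
  proof (induction I rule: infinite_finite_induct)
    case (insert i I)
    have "((\<lambda>z. (1 + of_real (p i) * z) * exp (- (of_real (p i) * z))) has_field_derivative 0) (at (0::complex))"
      by (auto intro!: derivative_eq_intros)
    from DERIV_mult[OF this insert.IH] show ?case
      using insert.hyps by simp
  qed simp_all
  then show ?thesis by (rule DERIV_imp_deriv)
qed

definition centered_coeff :: "'i set \<Rightarrow> ('i \<Rightarrow> real) \<Rightarrow> nat \<Rightarrow> complex" where
  "centered_coeff I p j = (deriv ^^ j) (centered_gf I p) 0 / fact j"

lemma centered_coeff_0 [simp]: "centered_coeff I p 0 = 1"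
  by (simp add: centered_coeff_def centered_gf_def)

lemma centered_coeff_1 [simp]: "centered_coeff I p (Suc 0) = 0"
  by (simp add: centered_coeff_def deriv_centered_gf_0)

lemma centered_coeff_sums: "(\<lambda>j. centered_coeff I p j * z ^ j) sums centered_gf I p z"
  using holomorphic_power_series[OF holomorphic_centered_gf, of z 0 "norm z + 1"]
  by (simp add: centered_coeff_def)

lemma norm_centered_coeff_le:
  assumes "r > 0"
  shows "norm (centered_coeff I p j) \<le> exp ((\<Sum>i\<in>I. (p i)\<^sup>2) * r\<^sup>2 / 2) / r ^ j"
proof -
  have "norm ((deriv ^^ j) (centered_gf I p) 0) \<le> fact j * exp ((\<Sum>i\<in>I. (p i)\<^sup>2) * r\<^sup>2 / 2) / r ^ j"
  proof (rule Cauchy_inequality)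
    show "continuous_on (cball 0 r) (centered_gf I p)"
      by (intro holomorphic_on_imp_continuous_on holomorphic_centered_gf)
    show "norm (centered_gf I p x) \<le> exp ((\<Sum>i\<in>I. (p i)\<^sup>2) * r\<^sup>2 / 2)" if "norm (0 - x) = r" for x
      using norm_centered_gf_le[of I p x] that by simp
  qed (use assms in \<open>auto intro: holomorphic_centered_gf\<close>)
  then show ?thesis
    by (simp add: centered_coeff_def norm_divide field_simps)
qed

text \<open>The induction step amounts to \<open>exp 1 \<le> (1 + 1 / x) ^ (j + 2)\<close> with
  \<open>x = j + 1\<close>.\<close>

lemma fact_le_Stirling: "(fact (Suc j) :: real) \<le> exp 1 * real (Suc j) * (real (Suc j) / exp 1) ^ Suc j"
proof (induction j)
  case 0
  then show ?case by simp
next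
  case (Suc j)
  define x where "x = real (Suc j)"
  have x: "x > 0" by (simp add: x_def)
  have "x / (x + 1) \<le> exp (- 1 / (x + 1))"
    using exp_ge_add_one_self[of "- 1 / (x + 1)"] x by (simp add: field_simps)
  then have "(x / (x + 1)) ^ Suc (Suc j) \<le> exp (- 1 / (x + 1)) ^ Suc (Suc j)"
    using x by (intro power_mono) auto
  also have "\<dots> = exp (- 1)"
    unfolding exp_of_nat_mult[symmetric] by (simp add: x_def field_simps)
  finally have e_le: "exp 1 * x ^ Suc (Suc j) \<le> (x + 1) ^ Suc (Suc j)"
    using x by (simp add: power_divide exp_minus field_simps del: power_Suc)
  have "(fact (Suc (Suc j)) :: real) = (x + 1) * fact (Suc j)"
    by (simp add: x_def fact_Suc[of "Suc j"] del: fact_Suc)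
  also have "\<dots> \<le> (x + 1) * (exp 1 * x * (x / exp 1) ^ Suc j)"
    using Suc.IH x by (simp add: x_def del: fact_Suc power_Suc of_nat_Suc)
  also have "\<dots> = (x + 1) * (exp 1 * x ^ Suc (Suc j)) / exp 1 ^ Suc j"
    by (simp add: power_divide)
  also have "\<dots> \<le> (x + 1) * (x + 1) ^ Suc (Suc j) / exp 1 ^ Suc j"
    using x e_le by (intro divide_right_mono mult_left_mono) auto
  also have "\<dots> = exp 1 * (x + 1) * ((x + 1) / exp 1) ^ Suc (Suc j)"
    by (simp add: power_divide)
  finally show ?case
    by (simp add: x_def add.commute del: fact_Suc power_Suc)
qed

lemma norm_centered_coeff_Suc_le:
  assumes d: "d = (\<Sum>i\<in>I. (p i)\<^sup>2)" and "d > 0"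
  shows "(norm (centered_coeff I p (Suc j)))\<^sup>2 * fact (Suc j) \<le> exp 1 * real (Suc j) * d ^ Suc j"
proof -
  \<comment> \<open>This radius minimises
    \<open>exp (d * r\<^sup>2 / 2) / r ^ Suc j\<close>.\<close>
  define r where "r = sqrt (real (Suc j) / d)"
  have r: "r > 0" and r2: "r\<^sup>2 = real (Suc j) / d"
    using \<open>d > 0\<close> by (simp_all add: r_def)
  have "norm (centered_coeff I p (Suc j)) \<le> exp (real (Suc j) / 2) / r ^ Suc j"
    using norm_centered_coeff_le[OF r, of I p "Suc j"] \<open>d > 0\<close> unfolding d[symmetric] r2 by simp
  then have "(norm (centered_coeff I p (Suc j)))\<^sup>2 \<le> (exp (real (Suc j) / 2) / r ^ Suc j)\<^sup>2"
    by (intro power_mono) auto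
  also have "\<dots> = exp 1 ^ Suc j / (r\<^sup>2) ^ Suc j"
    by (simp add: power_divide power_mult[symmetric] mult.commute[of 2] exp_of_nat_mult[symmetric] del: power_Suc)
  also have "\<dots> = (exp 1 * d / real (Suc j)) ^ Suc j"
    unfolding r2 by (simp add: power_divide power_mult_distrib del: power_Suc)
  finally have "(norm (centered_coeff I p (Suc j)))\<^sup>2 * fact (Suc j)
      \<le> (exp 1 * d / real (Suc j)) ^ Suc j * (exp 1 * real (Suc j) * (real (Suc j) / exp 1) ^ Suc j)"
    using \<open>d > 0\<close> by (intro mult_mono fact_le_Stirling) auto
  also have "\<dots> = exp 1 * real (Suc j) * d ^ Suc j"
    by (simp add: power_divide power_mult_distrib del: power_Suc)
  finally show ?thesis .
qed

text \<open>The generating function of \<open>w\<close> is the locally uniform limit near 0 of the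
  partial sums in powers of \<open>x - 1\<close>, so their Taylor coefficients at 0 converge to
  those of \<open>w\<close>.\<close>

lemma charlier_expansion:
  assumes gf: "\<And>x::complex. (\<Sum>k\<le>n. of_real (w k) * x ^ k) = (\<Prod>i\<in>I. 1 - of_real (p i) + of_real (p i) * x)"
    and w: "\<And>k. k > n \<Longrightarrow> w k = 0" and I: "finite I" and l: "l = (\<Sum>i\<in>I. p i)"
  shows "(\<lambda>m. \<Sum>j<m. Re (centered_coeff I p j) * charlier_mass l j k) \<longlonglongrightarrow> w k"
proof -
  define f where "f m x = (\<Sum>j<m. centered_coeff I p j * ((x - 1) ^ j * exp (of_real l * (x - 1))))" for m x
  define g where "g x = (\<Sum>k\<le>n. of_real (w k) * x ^ k :: complex)" for x
  have f_nth: "(deriv ^^ k) (f m) 0 / fact k = (\<Sum>j<m. centered_coeff I p j * of_real (charlier_mass l j k))" for m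
  proof -
    have "f m has_fps_expansion
        (\<Sum>j<m. fps_const (centered_coeff I p j) * Abs_fps (\<lambda>k. of_real (charlier_mass l j k)))"
      unfolding f_def[abs_def] by (intro fps_expansion_intros has_fps_expansion_charlier_mass)
    from fps_nth_fps_expansion[OF this, of k] show ?thesis
      by (simp add: fps_sum_nth)
  qed
  have g_nth: "(deriv ^^ k) g 0 / fact k = of_real (w k)"
  proof -
    have "g has_fps_expansion (\<Sum>k\<le>n. fps_const (of_real (w k)) * fps_X ^ k)"
      unfolding g_def[abs_def] by (intro fps_expansion_intros)
    moreover have "fps_nth (\<Sum>i\<le>n. fps_const (of_real (w i)) * fps_X ^ i) k = (of_real (w k) :: complex)"
      using w[of k] by (cases "k \<le> n") (simp_all add: fps_sum_nth fps_X_power_nth if_distrib[of "\<lambda>x. _ * x"] cong: if_cong)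
    ultimately show ?thesis
      by (metis fps_nth_fps_expansion)
  qed
  have g_eq: "g x = centered_gf I p (x - 1) * exp (of_real l * (x - 1))" for x
  proof -
    have "centered_gf I p (x - 1) * exp (of_real l * (x - 1))
        = (\<Prod>i\<in>I. (1 + of_real (p i) * (x - 1)) * exp (- (of_real (p i) * (x - 1))))
          * (\<Prod>i\<in>I. exp (of_real (p i) * (x - 1)))"
      using I by (simp add: centered_gf_def l sum_distrib_right flip: exp_sum)
    also have "\<dots> = (\<Prod>i\<in>I. 1 - of_real (p i) + of_real (p i) * x)"
      unfolding prod.distrib[symmetric]
      by (intro prod.cong) (auto simp: mult.assoc algebra_simps simp flip: exp_add)
    finally show ?thesis by (simp add: g_def gf)
  qed
  have "uniform_limit (ball 0 1) f g sequentially"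
  proof -
    \<comment> \<open>Cauchy's estimate on radius 4: since \<open>x - 1\<close> has norm at most 2
      on the unit disc, the terms decay like \<open>(1 / 2) ^ j\<close>.\<close>
    define B where "B = exp ((\<Sum>i\<in>I. (p i)\<^sup>2) * 4\<^sup>2 / 2)"
    have "norm (centered_coeff I p j * ((x - 1) ^ j * exp (of_real l * (x - 1))))
        \<le> B * exp (2 * \<bar>l\<bar>) * (1 / 2) ^ j" if "x \<in> ball 0 1" for x j
    proof -
      have x: "norm (x - 1) \<le> 2"
        using that norm_triangle_ineq4[of x 1] by simp
      have "norm (of_real l * (x - 1)) \<le> 2 * \<bar>l\<bar>"
        using mult_left_mono[OF x, of "\<bar>l\<bar>"] by (simp add: norm_mult)
      then have "norm (exp (of_real l * (x - 1))) \<le> exp (2 * \<bar>l\<bar>)"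
        using order_trans[OF norm_exp] exp_le_cancel_iff by blast
      moreover have "norm (centered_coeff I p j) \<le> B / 4 ^ j"
        unfolding B_def by (rule norm_centered_coeff_le) simp
      moreover have "norm (x - 1) ^ j \<le> 2 ^ j"
        by (intro power_mono x) simp
      ultimately have "norm (centered_coeff I p j * ((x - 1) ^ j * exp (of_real l * (x - 1))))
          \<le> B / 4 ^ j * (2 ^ j * exp (2 * \<bar>l\<bar>))"
        unfolding norm_mult norm_power by (intro mult_mono) (auto simp: B_def)
      also have "(4::real) ^ j = 2 ^ j * 2 ^ j"
        by (simp flip: power_mult_distrib)
      finally show ?thesis by (simp add: power_divide)
    qed
    then have "uniform_limit (ball 0 1) (\<lambda>m x. f m x)
        (\<lambda>x. \<Sum>j. centered_coeff I p j * ((x - 1) ^ j * exp (of_real l * (x - 1)))) sequentially"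
      unfolding f_def by (rule Weierstrass_m_test) (auto intro!: summable_mult summable_geometric)
    also have "(\<lambda>x. \<Sum>j. centered_coeff I p j * ((x - 1) ^ j * exp (of_real l * (x - 1)))) = g"
      unfolding mult.assoc[symmetric] g_eq
      by (intro ext sums_unique[symmetric] sums_mult2 centered_coeff_sums)
    finally show ?thesis by simp
  qed
  then have "(\<lambda>m. (deriv ^^ k) (f m) 0) \<longlonglongrightarrow> (deriv ^^ k) g 0"
    by (rule higher_deriv_complex_uniform_limit)
       (auto simp: f_def[abs_def] intro!: always_eventually holomorphic_intros)
  then have "(\<lambda>m. (deriv ^^ k) (f m) 0 / fact k) \<longlonglongrightarrow> (deriv ^^ k) g 0 / fact k"
    by (intro tendsto_divide tendsto_const) auto
  then have "(\<lambda>m. Re (\<Sum>j<m. centered_coeff I p j * of_real (charlier_mass l j k))) \<longlonglongrightarrow> Re (of_real (w k))"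
    unfolding f_nth g_nth by (rule tendsto_Re)
  then show ?thesis by simp
qed

section \<open>Upper bound for the chi-square distance and comparison with the entropy\<close>

lemma sum_mult_power_le:
  fixes x :: real
  assumes "0 \<le> x" "x < 1"
  shows "(\<Sum>j<m. if j < 2 then 0 else real j * x ^ j) \<le> 2 * x\<^sup>2 / (1 - x)\<^sup>2"
proof -
  have S: "(\<lambda>i. real (Suc i) * x ^ i) sums (1 / (1 - x)\<^sup>2)"
    using geometric_deriv_sums[of x] assms by simp
  have "(\<Sum>j<m. if j < 2 then 0 else real j * x ^ j)
      \<le> (\<Sum>j<Suc (Suc m). if j < 2 then 0 else real j * x ^ j)"
    using assms by (intro sum_mono2) auto
  also have "\<dots> = (\<Sum>i<m. real (Suc (Suc i)) * x ^ Suc (Suc i))"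
    by (simp add: sum.lessThan_Suc_shift del: sum.lessThan_Suc)
  also have "\<dots> \<le> (\<Sum>i<m. 2 * x\<^sup>2 * (real (Suc i) * x ^ i))"
  proof (intro sum_mono)
    fix i
    have "real (Suc (Suc i)) * x ^ Suc (Suc i) \<le> (2 * real (Suc i)) * x ^ Suc (Suc i)"
      using assms by (intro mult_right_mono) auto
    then show "real (Suc (Suc i)) * x ^ Suc (Suc i) \<le> 2 * x\<^sup>2 * (real (Suc i) * x ^ i)"
      by (simp add: power2_eq_square mult_ac del: of_nat_Suc)
  qed
  also have "\<dots> = 2 * x\<^sup>2 * (\<Sum>i<m. real (Suc i) * x ^ i)"
    by (simp add: sum_distrib_left)
  also have "\<dots> \<le> 2 * x\<^sup>2 * (1 / (1 - x)\<^sup>2)"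
    using sum_le_suminf[OF sums_summable[OF S], of "{..<m}"] sums_unique[OF S] assms
    by (intro mult_left_mono) auto
  finally show ?thesis by simp
qed

lemma chi2_bound:
  assumes gf: "\<And>x::complex. (\<Sum>k\<le>n. of_real (w k) * x ^ k) = (\<Prod>i\<in>I. 1 - of_real (p i) + of_real (p i) * x)"
    and w: "\<And>k. k > n \<Longrightarrow> w k = 0" and I: "finite I"
    and l: "l = (\<Sum>i\<in>I. p i)" and d: "d = (\<Sum>i\<in>I. (p i)\<^sup>2)" and dl: "0 < d" "d < l"
  shows "summable (\<lambda>k. (w k - poisson_mass l k)\<^sup>2 / poisson_mass l k)"
    and "(\<Sum>k. (w k - poisson_mass l k)\<^sup>2 / poisson_mass l k) \<le> 2 * exp 1 * (d / l)\<^sup>2 / (1 - d / l)\<^sup>2"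
proof -
  \<comment> \<open>The term of index 0 is the Poisson mass itself and that of index 1 vanishes, so
    dropping both expands the difference of the two laws.\<close>
  define c where "c j = (if j < 2 then 0 else Re (centered_coeff I p j))" for j
  have l0: "l > 0" using dl by simp
  have lim: "(\<lambda>m. \<Sum>j<m. c j * charlier_mass l j k) \<longlonglongrightarrow> w k - poisson_mass l k" for k
  proof -
    have "(\<lambda>m. (\<Sum>j<m. Re (centered_coeff I p j) * charlier_mass l j k) - poisson_mass l k)
        \<longlonglongrightarrow> w k - poisson_mass l k"
      by (intro tendsto_intros charlier_expansion[OF gf w I l])
    moreover have "\<forall>\<^sub>F m in sequentially.
        (\<Sum>j<m. Re (centered_coeff I p j) * charlier_mass l j k) - poisson_mass l k
        = (\<Sum>j<m. c j * charlier_mass l j k)"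
      using eventually_ge_at_top[of 2]
    proof eventually_elim
      case (elim m)
      define i where "i = m - 2"
      have "m = Suc (Suc i)" using elim by (simp add: i_def)
      then show ?case
        by (simp add: c_def sum.lessThan_Suc_shift del: sum.lessThan_Suc)
    qed
    ultimately show ?thesis by (rule Lim_transform_eventually)
  qed
  have bound: "(\<Sum>j<m. (c j)\<^sup>2 * fact j / l ^ j) \<le> 2 * exp 1 * (d / l)\<^sup>2 / (1 - d / l)\<^sup>2" for m
  proof -
    have "(c j)\<^sup>2 * fact j / l ^ j \<le> exp 1 * (if j < 2 then 0 else real j * (d / l) ^ j)" for j
    proof (cases "j < 2")
      case True
      then show ?thesis by (simp add: c_def)
    next
      case False
      then obtain i where j: "j = Suc i" by (cases j) auto
      have "(c j)\<^sup>2 \<le> (norm (centered_coeff I p j))\<^sup>2"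
        using False abs_Re_le_cmod[of "centered_coeff I p j"] by (simp add: c_def abs_le_square_iff[symmetric])
      then have "(c j)\<^sup>2 * fact j \<le> (norm (centered_coeff I p j))\<^sup>2 * fact j"
        by (intro mult_right_mono) auto
      also have "\<dots> \<le> exp 1 * real j * d ^ j"
        unfolding j by (rule norm_centered_coeff_Suc_le[OF d dl(1)])
      finally have "(c j)\<^sup>2 * fact j / l ^ j \<le> exp 1 * real j * d ^ j / l ^ j"
        using l0 by (intro divide_right_mono) auto
      then show ?thesis using False by (simp add: power_divide)
    qed
    then have "(\<Sum>j<m. (c j)\<^sup>2 * fact j / l ^ j)
        \<le> exp 1 * (\<Sum>j<m. if j < 2 then 0 else real j * (d / l) ^ j)"
      unfolding sum_distrib_left by (intro sum_mono)
    also have "\<dots> \<le> exp 1 * (2 * (d / l)\<^sup>2 / (1 - d / l)\<^sup>2)"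
      using dl by (intro mult_left_mono sum_mult_power_le) auto
    finally show ?thesis by (simp add: mult_ac)
  qed
  show "summable (\<lambda>k. (w k - poisson_mass l k)\<^sup>2 / poisson_mass l k)"
    by (rule charlier_expansion_norm_le(1)[OF l0 lim bound])
  show "(\<Sum>k. (w k - poisson_mass l k)\<^sup>2 / poisson_mass l k) \<le> 2 * exp 1 * (d / l)\<^sup>2 / (1 - d / l)\<^sup>2"
    by (rule charlier_expansion_norm_le(2)[OF l0 lim bound])
qed

text \<open>From \<open>ln t \<le> t - 1\<close>, each entropy term is at most the chi-square term
  plus \<open>w k - v k\<close>, and these differences sum to 0.\<close>

lemma entropy_le_chi2:
  fixes w v :: "nat \<Rightarrow> real"
  assumes v: "\<And>k. v k > 0" and w: "\<And>k. w k \<ge> 0" and "w sums 1" and "v sums 1"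
    and h: "summable (\<lambda>k. w k * ln (w k / v k))" and c: "summable (\<lambda>k. (w k - v k)\<^sup>2 / v k)"
  shows "relative_entropy w v \<le> chi2_distance w v"
proof -
  have S: "(\<lambda>k. (w k - v k)\<^sup>2 / v k + (w k - v k)) sums (chi2_distance w v + (1 - 1))"
    unfolding chi2_distance_def using assms by (intro sums_add sums_diff summable_sums)
  have "w k * ln (w k / v k) \<le> (w k - v k)\<^sup>2 / v k + (w k - v k)" for k
  proof (cases "w k = 0")
    case True
    then show ?thesis using v[of k] by (simp add: power2_eq_square)
  next
    case False
    then have "w k > 0" using w[of k] by simp
    then have "w k * ln (w k / v k) \<le> w k * (w k / v k - 1)"
      using v[of k] by (intro mult_left_mono ln_le_minus_one) auto
    also have "\<dots> = (w k - v k)\<^sup>2 / v k + (w k - v k)"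
      using v[of k] by (simp add: field_simps power2_eq_square)
    finally show ?thesis .
  qed
  then show ?thesis
    using suminf_le[OF _ h sums_summable[OF S]] sums_unique[OF S] by (simp add: relative_entropy_def)
qed

text \<open>The factorial moments are derivatives at 1 of the generating polynomial, computed from
  its product form.\<close>

lemma bernoulli_sum_moments:
  fixes w p :: "_ \<Rightarrow> real"
  assumes gf: "\<And>x::real. (\<Sum>k\<le>n. w k * x ^ k) = (\<Prod>i\<in>I. 1 - p i + p i * x)" and I: "finite I"
  shows "(\<Sum>k\<le>n. w k) = 1"
    and "(\<Sum>k\<le>n. w k * real k) = (\<Sum>i\<in>I. p i)"
    and "(\<Sum>k\<le>n. w k * (real k * (real k - 1))) = (\<Sum>i\<in>I. p i)\<^sup>2 - (\<Sum>i\<in>I. (p i)\<^sup>2)"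
proof -
  have prod: "poly (\<Prod>i\<in>I. [:1 - p i, p i:]) 1 = 1 \<and>
    poly (pderiv (\<Prod>i\<in>I. [:1 - p i, p i:])) 1 = (\<Sum>i\<in>I. p i) \<and>
    poly (pderiv (pderiv (\<Prod>i\<in>I. [:1 - p i, p i:]))) 1 = (\<Sum>i\<in>I. p i)\<^sup>2 - (\<Sum>i\<in>I. (p i)\<^sup>2)"
    using I
  proof induction
    case (insert i I)
    then show ?case
      by (simp add: pderiv_mult pderiv_add pderiv_smult pderiv_pCons del: mult_pCons_left)
         (simp add: power2_eq_square algebra_simps)
  qed simp
  note pderiv_sum = higher_pderiv_sum[of 1, simplified]
  have eq: "(\<Sum>k\<le>n. monom (w k) k) = (\<Prod>i\<in>I. [:1 - p i, p i:])"
    by (rule poly_eq_poly_eq_iff[THEN iffD1], rule ext) (simp add: poly_sum poly_prod poly_monom gf mult.commute)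
  show "(\<Sum>k\<le>n. w k) = 1"
    using prod[folded eq] by (simp add: poly_sum poly_monom)
  show "(\<Sum>k\<le>n. w k * real k) = (\<Sum>i\<in>I. p i)"
    using prod[folded eq] by (simp add: poly_sum poly_monom pderiv_sum pderiv_monom mult.commute)
  \<comment> \<open>Differentiating monomials produces truncated subtraction; at
    \<open>k = 0\<close> both sides vanish.\<close>
  have falling: "w k * (real k * (real k - 1)) = real (k - Suc 0) * (real k * w k)" for k
    by (cases k) auto
  show "(\<Sum>k\<le>n. w k * (real k * (real k - 1))) = (\<Sum>i\<in>I. p i)\<^sup>2 - (\<Sum>i\<in>I. (p i)\<^sup>2)"
    unfolding falling using prod[folded eq] by (simp add: poly_sum poly_monom pderiv_sum pderiv_monom)
qed

section \<open>Law of a Bernoulli sum\<close>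

lemma (in prob_space) has_bochner_integral_bounded_nat:
  fixes W :: "'a \<Rightarrow> nat" and f :: "nat \<Rightarrow> 'b :: {real_normed_algebra_1, banach, second_countable_topology}"
  assumes [measurable]: "W \<in> measurable M (count_space UNIV)" and "AE \<omega> in M. W \<omega> \<le> n"
  shows "has_bochner_integral M (\<lambda>\<omega>. f (W \<omega>)) (\<Sum>k\<le>n. of_real (mass M W k) * f k)"
proof -
  let ?A = "\<lambda>k. {\<omega> \<in> space M. W \<omega> = k}"
  have "has_bochner_integral M (\<lambda>\<omega>. \<Sum>k\<le>n. indicator (?A k) \<omega> *\<^sub>R f k) (\<Sum>k\<le>n. measure M (?A k) *\<^sub>R f k)"
    by (intro has_bochner_integral_sum has_bochner_integral_scaleR_left has_bochner_integral_real_indicator)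
       (simp_all add: emeasure_eq_measure)
  also have "?this \<longleftrightarrow> has_bochner_integral M (\<lambda>\<omega>. f (W \<omega>)) (\<Sum>k\<le>n. measure M (?A k) *\<^sub>R f k)"
  proof (rule has_bochner_integral_cong_AE)
    show "AE \<omega> in M. (\<Sum>k\<le>n. indicator (?A k) \<omega> *\<^sub>R f k) = f (W \<omega>)"
      using assms(2) AE_space
      by eventually_elim (simp add: indicator_def of_bool_def if_distrib[of "\<lambda>x. x *\<^sub>R _"] cong: if_cong)
  qed measurable
  finally show ?thesis
    by (simp add: mass_def scaleR_conv_of_real)
qed

text \<open>Independence factorises the expectation of \<open>x ^ W\<close>. The field is generic
  because moments use real \<open>x\<close> and the Charlier expansion complex
  \<open>x\<close>.\<close>

lemma (in prob_space) bernoulli_sum_gf: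
  fixes x :: "'b :: {real_normed_field, banach, second_countable_topology}"
  assumes I: "finite I" and indep: "indep_vars (\<lambda>_. count_space UNIV) X I"
    and p1: "\<And>i. i \<in> I \<Longrightarrow> mass M (X i) 1 = p i"
    and p0: "\<And>i. i \<in> I \<Longrightarrow> mass M (X i) 0 = 1 - p i"
  defines "W \<equiv> \<lambda>\<omega>. \<Sum>i\<in>I. X i \<omega>"
  shows "(\<Sum>k\<le>card I. of_real (mass M W k) * x ^ k) = (\<Prod>i\<in>I. 1 - of_real (p i) + of_real (p i) * x)"
    and "\<And>k. k > card I \<Longrightarrow> mass M W k = 0"
proof -
  have X: "X i \<in> measurable M (count_space UNIV)" if "i \<in> I" for i
    using indep that by (auto simp: indep_vars_def)
  have W: "W \<in> measurable M (count_space UNIV)"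
    unfolding W_def using X by measurable
  \<comment> \<open>The masses at 0 and 1 add up to 1, so other values occur with probability
    0.\<close>
  have X_le: "AE \<omega> in M. X i \<omega> \<le> 1" if i: "i \<in> I" for i
  proof -
    note [measurable] = X[OF i]
    have "prob {\<omega> \<in> space M. X i \<omega> \<le> 1} = prob ({\<omega> \<in> space M. X i \<omega> = 0} \<union> {\<omega> \<in> space M. X i \<omega> = 1})"
      by (intro arg_cong[of _ _ prob]) auto
    also have "\<dots> = 1"
      using p0[OF i] p1[OF i] by (subst finite_measure_Union) (auto simp: mass_def)
    finally show ?thesis
      by (simp add: prob_Collect_eq_1)
  qed
  have "AE \<omega> in M. \<forall>i\<in>I. X i \<omega> \<le> 1"
    using X_le I by (simp add: AE_finite_all)
  then have W_le: "AE \<omega> in M. W \<omega> \<le> card I"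
  proof eventually_elim
    case (elim \<omega>)
    then show ?case using sum_mono[of I "\<lambda>i. X i \<omega>" "\<lambda>_. 1"] by (simp add: W_def)
  qed
  have gf_X: "has_bochner_integral M (\<lambda>\<omega>. x ^ X i \<omega>) (1 - of_real (p i) + of_real (p i) * x)" if "i \<in> I" for i
    using has_bochner_integral_bounded_nat[OF X[OF that] X_le[OF that], of "\<lambda>k. x ^ k"] p0[OF that] p1[OF that]
    by simp
  have "(\<Sum>k\<le>card I. of_real (mass M W k) * x ^ k) = expectation (\<lambda>\<omega>. x ^ W \<omega>)"
    by (rule has_bochner_integral_integral_eq[symmetric]) (rule has_bochner_integral_bounded_nat[OF W W_le])
  also have "\<dots> = expectation (\<lambda>\<omega>. \<Prod>i\<in>I. x ^ X i \<omega>)"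
    by (simp add: W_def power_sum)
  also have "\<dots> = (\<Prod>i\<in>I. expectation (\<lambda>\<omega>. x ^ X i \<omega>))"
  proof (rule indep_vars_lebesgue_integral[OF I])
    show "indep_vars (\<lambda>_. borel) (\<lambda>i \<omega>. x ^ X i \<omega>) I"
      by (rule indep_vars_compose2[OF indep]) simp
  qed (use gf_X in \<open>auto simp: has_bochner_integral_iff\<close>)
  also have "\<dots> = (\<Prod>i\<in>I. 1 - of_real (p i) + of_real (p i) * x)"
    using gf_X by (intro prod.cong) (auto simp: has_bochner_integral_iff)
  finally show "(\<Sum>k\<le>card I. of_real (mass M W k) * x ^ k) = (\<Prod>i\<in>I. 1 - of_real (p i) + of_real (p i) * x)" .
  show "mass M W k = 0" if "k > card I" for k
  proof -
    have "AE \<omega> in M. W \<omega> \<noteq> k"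
      using W_le by eventually_elim (use that in auto)
    then show ?thesis
      using W unfolding mass_def by (subst prob_eq_0) auto
  qed
qed

section \<open>Both bounds for the Bernoulli sum\<close>

theorem proposition6p2:
  fixes n :: nat and p :: "nat \<Rightarrow> real" and lam lam2 \<kappa> :: real
    and M :: "'a measure" and X :: "nat \<Rightarrow> 'a \<Rightarrow> nat" and W :: "'a \<Rightarrow> nat"
    and N :: "'b measure" and Z :: "'b \<Rightarrow> nat"
    and w v :: "nat \<Rightarrow> real"
  assumes "n \<ge> 1"
    and "\<And>j. j \<in> {1..n} \<Longrightarrow> p j \<in> {0..1}"
    and "lam = (\<Sum>j=1..n. p j)"
    and "lam2 = (\<Sum>j=1..n. (p j)\<^sup>2)"
    and "prob_space M"
    and "prob_space.indep_vars M (\<lambda>_. count_space UNIV) X {1..n}"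
    and "\<And>j. j \<in> {1..n} \<Longrightarrow> measure M {\<omega> \<in> space M. X j \<omega> = 1} = p j"
    and "\<And>j. j \<in> {1..n} \<Longrightarrow> measure M {\<omega> \<in> space M. X j \<omega> = 0} = 1 - p j"
    and "W = (\<lambda>\<omega>. \<Sum>j=1..n. X j \<omega>)"
    and "prob_space N"
    and "Z \<in> measurable N (count_space UNIV)"
    and "distr N (count_space UNIV) Z = measure_pmf (poisson_pmf lam)"
    and "w = mass M W"
    and "v = mass N Z"
    and "lam \<ge> 1/2"
    and "0 < \<kappa>" and "\<kappa> < 1"
    and "lam2 \<le> \<kappa> * lam"
  shows "summable (\<lambda>k. w k * ln (w k / v k))
    \<and> summable (\<lambda>k. (w k - v k)\<^sup>2 / v k)
    \<and> 1/4 * (lam2 / lam)\<^sup>2 \<le> relative_entropy w v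
    \<and> relative_entropy w v \<le> chi2_distance w v
    \<and> chi2_distance w v \<le> 7 * 10 ^ 6 * (1 - \<kappa>) powi (-3) * (lam2 / lam)\<^sup>2"
proof -
  have lam: "lam > 0" using \<open>lam \<ge> 1/2\<close> by simp
  \<comment> \<open>Positivity of \<open>lam2\<close> makes the Cauchy radius finite; otherwise all
    \<open>p j\<close>, and so \<open>lam\<close>, would vanish.\<close>
  have "lam2 \<noteq> 0"
  proof
    assume "lam2 = 0"
    then have "\<forall>j\<in>{1..n}. p j = 0"
      using assms(4) by (simp add: sum_nonneg_eq_0_iff)
    then show False using assms(3) lam by simp
  qed
  moreover have "lam2 \<ge> 0"
    unfolding assms(4) by (intro sum_nonneg) simp
  ultimately have lam2: "lam2 > 0" by simp
  have ratio: "lam2 / lam \<le> \<kappa>"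
    using lam \<open>lam2 \<le> \<kappa> * lam\<close> by (simp add: pos_divide_le_eq)
  have lam2_less: "lam2 < lam"
    using mult_strict_right_mono[OF \<open>\<kappa> < 1\<close> lam] \<open>lam2 \<le> \<kappa> * lam\<close> by simp
  have v: "v = poisson_mass lam"
  proof
    fix k
    have "v k = measure (distr N (count_space UNIV) Z) {k}"
      using assms(11) unfolding assms(14) mass_def
      by (subst measure_distr) (auto intro!: arg_cong[of _ _ "measure N"])
    also have "\<dots> = poisson_mass lam k"
      using lam by (simp add: assms(12) measure_pmf_single poisson_mass_def)
    finally show "v k = poisson_mass lam k" .
  qed
  have v_pos: "v k > 0" for k
    unfolding v by (rule poisson_mass_pos[OF lam])

  note gf = prob_space.bernoulli_sum_gf[OF \<open>prob_space M\<close> finite_atLeastAtMost assms(6), of p,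
      unfolded mass_def[of M "X _"], OF assms(7,8), folded assms(9), folded assms(13), simplified card_atLeastAtMost diff_Suc_1]
  have w0: "w k = 0" if "k > n" for k
    using gf(2)[of k] that by simp
  have gf_real: "(\<Sum>k\<le>n. w k * x ^ k) = (\<Prod>i=1..n. 1 - p i + p i * x)" for x :: real
    using gf(1)[of x] by simp
  have gf_complex: "(\<Sum>k\<le>n. of_real (w k) * x ^ k) = (\<Prod>i=1..n. 1 - of_real (p i) + of_real (p i) * x)" for x :: complex
    using gf(1)[of x] by simp
  note moments = bernoulli_sum_moments[OF gf_real finite_atLeastAtMost, folded assms(3,4)]
  have w_nonneg: "w k \<ge> 0" for k
    unfolding assms(13) mass_def by simp
  have entropy: "(\<lambda>k. w k * ln (w k / v k)) sums (\<Sum>k\<le>n. w k * ln (w k / v k))"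
    by (rule sums_finite) (use w0 in \<open>auto simp: not_le\<close>)
  have w_sums: "w sums 1"
    using sums_finite[of "{..n}" w] w0 moments(1) by (simp add: not_le)
  note chi2 = chi2_bound[OF gf_complex w0 finite_atLeastAtMost assms(3,4) lam2 lam2_less, folded v]

  have "1/4 * (lam2 / lam)\<^sup>2 \<le> relative_entropy w v"
    using entropy_lower_bound[OF lam less_imp_le[OF lam2] w_nonneg moments]
      sums_unique[OF entropy] by (simp add: relative_entropy_def v)
  moreover have "relative_entropy w v \<le> chi2_distance w v"
    using entropy_le_chi2[OF v_pos w_nonneg w_sums _ sums_summable[OF entropy] chi2(1)]
      poisson_mass_sums[of lam] by (simp add: v)
  moreover have "chi2_distance w v \<le> 7 * 10 ^ 6 * (1 - \<kappa>) powi (-3) * (lam2 / lam)\<^sup>2"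
  proof -
    have "chi2_distance w v \<le> 2 * exp 1 * (lam2 / lam)\<^sup>2 / (1 - lam2 / lam)\<^sup>2"
      using chi2(2) by (simp add: chi2_distance_def)
    \<comment> \<open>The estimate has exponent 2; the third power only enlarges it, as
      \<open>1 - \<kappa>\<close> lies between 0 and 1. The constant then follows from
      \<open>exp 1 \<le> 3\<close>.\<close>
    also have "\<dots> \<le> 2 * exp 1 * (lam2 / lam)\<^sup>2 / (1 - \<kappa>) ^ 3"
    proof (rule divide_left_mono)
      have "(1 - \<kappa>) ^ 3 \<le> (1 - \<kappa>)\<^sup>2"
        using \<open>0 < \<kappa>\<close> \<open>\<kappa> < 1\<close> by (intro power_decreasing) auto
      also have "\<dots> \<le> (1 - lam2 / lam)\<^sup>2"
        using ratio \<open>\<kappa> < 1\<close> by (intro power_mono) auto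
      finally show "(1 - \<kappa>) ^ 3 \<le> (1 - lam2 / lam)\<^sup>2" .
    qed (use lam lam2_less \<open>\<kappa> < 1\<close> in \<open>auto intro!: mult_pos_pos\<close>)
    also have "\<dots> \<le> (7 * 10 ^ 6) * (lam2 / lam)\<^sup>2 / (1 - \<kappa>) ^ 3"
      using exp_le \<open>\<kappa> < 1\<close> by (intro divide_right_mono mult_right_mono) auto
    finally show ?thesis
      by (simp add: power_int_minus field_simps)
  qed
  ultimately show ?thesis
    using sums_summable[OF entropy] chi2(1) by blast
qed

end
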